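(* For every order $r\in\{1,2,3,\ldots\}$, on the random model $(\Omega_n,P_n)$, \[ \sqrt{n}\left(\frac{S_{r+1,n}}{n}-\frac{1}{4^r}\right)\Rightarrow N\left(0,\,\frac{1}{3}\cdot\frac{4^r-1}{16^r}\right)\qquad (n\to\infty), \] where $\Rightarrow$ denotes convergence in distribution and $N(\mu,\sigma^2)$ is the normal distribution with mean $\mu$ and variance $\sigma^2$.
   Context: For $n\ge 1$, let $\Omega_n$ be the set of rooted plane (ordered) full binary trees with $n$ leaves (every internal node has exactly two children, left and right distinguished), so $|\Omega_n|=\frac{(2n-2)!}{n!(n-1)!}$. The random model is $\Omega_n$ with the uniform probability measure $P_n$. Horton–Strahler ordering: every leaf has order 1; an internal node whose two children have different orders $r_1\neq r_2$ has order $\max\{r_1,r_2\}$; an internal node whose two children both have order $r$ has order $r+1$. A branch of order $r$ is a maximal connected path consisting of nodes all of order $r$. For $\tau\in\Omega_n$, $S_{r,n}(\tau)$ denotes the number of branches of order $r$ in $\tau$ (so $S_{1,n}=n$). *)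

theory Defs
  imports "HOL-Probability.Probability"
begin

datatype fbtree = Leaf | Node fbtree fbtree

fun leaves :: "fbtree \<Rightarrow> nat" where
  "leaves Leaf = 1"
| "leaves (Node l r) = leaves l + leaves r"

definition Omega :: "nat \<Rightarrow> fbtree set" where
  "Omega n = {t. leaves t = n}"

fun hs_order :: "fbtree \<Rightarrow> nat" where
  "hs_order Leaf = 1"
| "hs_order (Node l r) =
     (if hs_order l = hs_order r then hs_order l + 1 else max (hs_order l) (hs_order r))"

text \<open>A node of order r has at most one child of order r, so every branch of
  order r (maximal connected path of order-r nodes) has a unique top node: a node
  of order r that is the root or whose parent has order different from r.
  branches_aux r p t counts such top nodes in t, where p is the order of the parent
  of the root of t (p = 0 for the root of the whole tree; all orders are >= 1).\<close>
fun branches_aux :: "nat \<Rightarrow> nat \<Rightarrow> fbtree \<Rightarrow> nat" where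
  "branches_aux r p Leaf = (if hs_order Leaf = r \<and> p \<noteq> r then 1 else 0)"
| "branches_aux r p (Node a b) =
     (if hs_order (Node a b) = r \<and> p \<noteq> r then 1 else 0)
     + branches_aux r (hs_order (Node a b)) a + branches_aux r (hs_order (Node a b)) b"

definition S :: "nat \<Rightarrow> fbtree \<Rightarrow> nat" where
  "S r t = branches_aux r 0 t"

definition P :: "nat \<Rightarrow> fbtree pmf" where
  "P n = pmf_of_set (Omega n)"

end

theory Submission
  imports Defs "HOL-Computational_Algebra.Formal_Power_Series"
begin

text \<open>
  Pruning (deleting all leaves and contracting the nodes with one child) lowers every
  Horton--Strahler order by one, so \<open>S (r + 1) t = S r (prune t)\<close>. Every tree with \<open>m\<close> leaves is the
  pruning of the same number \<open>2^(n - 2m) * (n - 2 choose 2m - 2)\<close> of trees with \<open>n\<close> leaves, so given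
  its number \<open>M\<close> of leaves the pruned tree is again uniform. The weights of consecutive values of \<open>M\<close>
  have a rational ratio, which by summation by parts gives the Stein identity
  \<open>E[(n - 2M)(n - 2M - 1) f(M + 1)] = E[4M(M - 1) f(M)]\<close>. With \<open>Y = M - n/4\<close>, the choice \<open>f = Y\<close>
  yields \<open>E Y\<^sup>2 \<le> n\<close>, and \<open>f = exp(i \<theta> Y)\<close> shows that \<open>\<psi>(\<theta>) = E exp(i \<theta> Y)\<close> satisfies
  \<open>\<psi>' = - (n/16) \<theta> \<psi> + O(1)\<close> for \<open>|\<theta>| sqrt n\<close> bounded, whence \<open>\<psi>(\<theta>) = exp(- n \<theta>\<^sup>2/32) + O(\<theta>)\<close>.
  Conditioning on the pruned tree propagates this to all orders, with limit variances
  \<open>v(r + 1) = v(r)/4 + 1/16^(r + 1)\<close>, and Levy's continuity theorem concludes.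
\<close>

subsection \<open>Pruning\<close>

text \<open>The value at \<open>Leaf\<close> is junk (its pruning is the empty tree), hence the restriction to \<open>n \<ge> 2\<close>.\<close>
fun prune :: "fbtree \<Rightarrow> fbtree" where
  "prune Leaf = Leaf"
| "prune (Node l r) =
     (if l = Leaf then prune r else if r = Leaf then prune l else Node (prune l) (prune r))"

lemma hs_order_pos [simp]: "hs_order t > 0"
  by (induction t) auto

lemma hs_order_Node_ge_2: "hs_order (Node l r) \<ge> 2"
  using hs_order_pos[of l] hs_order_pos[of r]
  by (auto simp: max_def simp del: hs_order_pos)

text \<open>A cherry becomes a leaf, and a node with one leaf child takes its order from the other
  child, whose order is at least 2. Where both children survive, both orders drop by one, so the tie
  or maximum is decided as before.\<close>

lemma hs_order_prune: "t \<noteq> Leaf \<Longrightarrow> hs_order t = Suc (hs_order (prune t))"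
proof (induction t)
  case (Node l r)
  show ?case
  proof (cases "l = Leaf \<or> r = Leaf")
    case True
    then show ?thesis
    proof
      assume "l = Leaf"
      then show ?thesis using Node hs_order_pos[of "prune r"] by (cases "r = Leaf") (auto simp del: hs_order_pos)
    next
      assume "r = Leaf"
      then show ?thesis using Node hs_order_pos[of "prune l"] by (cases "l = Leaf") (auto simp del: hs_order_pos)
    qed
  next
    case False
    then show ?thesis using Node by (simp add: max_def)
  qed
qed auto

text \<open>The parent order \<open>p\<close> affects only the indicator of the root, and passing
  the root's own order switches that indicator off.\<close>

lemma branches_aux_root:
  "branches_aux r p t = (if hs_order t = r \<and> p \<noteq> r then 1 else 0) + branches_aux r (hs_order t) t"
  by (cases t) auto

text \<open>A contracted node shares the order of its surviving child, so contraction only shortens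
  branches; the removed leaves have order 1 and are not counted. A parent order matters only through
  its comparison with the counted order, and this equivalence passes down to the children.\<close>

lemma branches_aux_prune:
  assumes "t \<noteq> Leaf" "r > 0" "p = Suc r \<longleftrightarrow> q = r"
  shows "branches_aux (Suc r) p t = branches_aux r q (prune t)"
  using assms
proof (induction t arbitrary: p q)
  case (Node a b)
  show ?case
  proof (cases "a = Leaf \<or> b = Leaf")
    case True
    show ?thesis
    proof (cases "a = Leaf \<and> b = Leaf")
      case True
      then show ?thesis using Node by simp
    next
      case False
      \<comment> \<open>\<open>c\<close> is the surviving child. It has the order of its parent, so
        it never starts a branch.\<close>
      define c where "c = (if a = Leaf then b else a)"
      have c: "c \<noteq> Leaf" "prune (Node a b) = prune c" "hs_order (Node a b) = hs_order c"
        using True False hs_order_prune[of "Node a b"] hs_order_prune[of c]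
        by (auto simp: c_def)
      have IH: "branches_aux (Suc r) (hs_order c) c = branches_aux r (hs_order (prune c)) (prune c)"
        using Node True False c hs_order_prune[of c]
        by (cases "a = Leaf") (auto simp: c_def)
      have "branches_aux (Suc r) p (Node a b)
          = (if hs_order c = Suc r \<and> p \<noteq> Suc r then 1 else 0) + branches_aux (Suc r) (hs_order c) c"
        using True False \<open>r > 0\<close> unfolding branches_aux.simps(2) c(3)
        by (auto simp: c_def)
      also have "\<dots> = branches_aux r q (prune c)"
        using Node.prems hs_order_prune[OF c(1)] branches_aux_root[of r q "prune c"] IH by simp
      finally show ?thesis using c by simp
    qed
  next
    case False
    then show ?thesis
      using Node hs_order_prune[of a] hs_order_prune[of b] by (auto simp: max_def)
  qed
qed auto

lemma S_Suc_prune: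
  assumes "t \<noteq> Leaf" "r > 0"
  shows "S (Suc r) t = S r (prune t)"
  unfolding S_def using assms by (intro branches_aux_prune) auto

text \<open>Internal nodes have order at least 2, so each leaf is a whole branch of order 1.\<close>

lemma S_1_eq_leaves: "S 1 t = leaves t"
proof -
  have "p \<noteq> 1 \<Longrightarrow> branches_aux 1 p t = leaves t" for p
  proof (induction t arbitrary: p)
    case (Node a b)
    then show ?case using hs_order_Node_ge_2[of a b] unfolding branches_aux.simps by auto
  qed auto
  then show ?thesis by (simp add: S_def)
qed

subsection \<open>Counting trees and the fibres of pruning\<close>

lemma leaves_pos [simp]: "leaves t > 0"
  by (induction t) auto

lemma leaves_neq_0 [simp]: "leaves t \<noteq> 0"
  using leaves_pos[of t] by linarith

lemma leaves_eq_1_iff: "leaves t = 1 \<longleftrightarrow> t = Leaf"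
proof (cases t)
  case (Node l r)
  then show ?thesis using leaves_pos[of l] leaves_pos[of r] by (auto simp del: leaves_pos)
qed auto

lemma leaves_prune: "t \<noteq> Leaf \<Longrightarrow> 2 * leaves (prune t) \<le> leaves t"
proof (induction t)
  case (Node l r)
  then show ?case using leaves_pos[of l] leaves_pos[of r] by (cases "l = Leaf"; cases "r = Leaf") auto
qed auto

lemma mem_Omega: "t \<in> Omega n \<longleftrightarrow> leaves t = n"
  by (simp add: Omega_def)

lemma Omega_0 [simp]: "Omega 0 = {}"
  by (auto simp: mem_Omega)

lemma Omega_1 [simp]: "Omega (Suc 0) = {Leaf}"
  by (auto simp: mem_Omega leaves_eq_1_iff[unfolded One_nat_def])

lemma Omega_rec:
  assumes "n \<noteq> 1"
  shows "Omega n = (\<lambda>(a, b). Node a b) ` (\<Union>i\<in>{..n}. Omega i \<times> Omega (n - i))"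
proof (intro set_eqI iffI)
  fix t assume t: "t \<in> Omega n"
  then obtain a b where "t = Node a b"
    using assms by (cases t) (auto simp: mem_Omega)
  with t show "t \<in> (\<lambda>(a, b). Node a b) ` (\<Union>i\<in>{..n}. Omega i \<times> Omega (n - i))"
    by (intro image_eqI[of _ _ "(a, b)"]) (auto simp: mem_Omega)
qed (auto simp: mem_Omega)

lemma finite_Omega [simp]: "finite (Omega n)"
proof (induction n rule: less_induct)
  case (less n)
  show ?case
  proof (cases "n = 1")
    case False
    \<comment> \<open>For \<open>i = 0\<close> or \<open>i = n\<close> one factor is
      \<open>Omega n\<close>, outside the induction hypothesis, but the other is empty.\<close>
    have "finite (Omega i \<times> Omega (n - i))" if "i \<le> n" for i
      using less[of i] less[of "n - i"] that by (cases "i = 0"; cases "i = n") auto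
    with False show ?thesis by (subst Omega_rec) auto
  qed auto
qed

section \<open>The recurrence for the number of trees\<close>

lemma card_Omega_rec:
  assumes "n \<noteq> 1"
  shows "card (Omega n) = (\<Sum>i\<le>n. card (Omega i) * card (Omega (n - i)))"
proof -
  have "card (Omega n) = card (\<Union>i\<in>{..n}. Omega i \<times> Omega (n - i))"
    by (subst Omega_rec[OF assms], intro card_image) (auto simp: inj_on_def)
  also have "\<dots> = (\<Sum>i\<le>n. card (Omega i \<times> Omega (n - i)))"
    by (intro card_UN_disjoint) (auto simp: mem_Omega)
  finally show ?thesis by (simp add: card_cartesian_product)
qed

text \<open>The generating function satisfies \<open>C = X + C\<^sup>2\<close>, hence \<open>(1 - 4 X) C' = 1 - 2 C\<close>.\<close>
lemma card_Omega_Suc: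
  assumes "n > 0"
  shows "(real n + 1) * real (card (Omega (Suc n))) = (4 * real n - 2) * real (card (Omega n))"
proof -
  define C :: "real fps" where "C = Abs_fps (\<lambda>n. real (card (Omega n)))"
  have C: "C = fps_X + C\<^sup>2"
  proof (rule fps_ext)
    fix n show "fps_nth C n = fps_nth (fps_X + C\<^sup>2) n"
    proof (cases "n = 1")
      case True
      then show ?thesis by (simp add: C_def power2_eq_square fps_mult_nth)
    next
      case False
      then show ?thesis
        using card_Omega_rec[OF False] by (simp add: C_def power2_eq_square fps_mult_nth fps_X_nth atMost_atLeast0)
    qed
  qed
  have "fps_deriv C = fps_deriv (fps_X + C\<^sup>2)"
    using C by simp
  then have 1: "fps_deriv C * (1 - 2 * C) = 1"
    by (simp add: algebra_simps power2_eq_square)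
  \<comment> \<open>This completes the square in the quadratic equation for \<open>C\<close>, so one
    more factor \<open>1 - 2 * C\<close> makes the differential equation linear.\<close>
  have 2: "(1 - 2 * C)\<^sup>2 = 1 - 4 * fps_X"
  proof -
    have "(1 - 2 * C)\<^sup>2 = 1 - 4 * (C - C\<^sup>2)" by (simp add: algebra_simps power2_eq_square)
    also have "C - C\<^sup>2 = fps_X" using C by (metis add_diff_cancel_right')
    finally show ?thesis .
  qed
  have "fps_deriv C * (1 - 4 * fps_X) = (fps_deriv C * (1 - 2 * C)) * (1 - 2 * C)"
    unfolding 2[symmetric] by (simp add: power2_eq_square mult.assoc)
  then have "fps_deriv C - fps_const 4 * (fps_X * fps_deriv C) = 1 - fps_const 2 * C"
    unfolding 1 by (simp add: algebra_simps numeral_fps_const)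
  \<comment> \<open>At an index \<open>n > 0\<close> the constant 1 on the right contributes
    nothing.\<close>
  then have "fps_nth (fps_deriv C - fps_const 4 * (fps_X * fps_deriv C)) n = fps_nth (1 - fps_const 2 * C) n"
    by (rule arg_cong)
  then show ?thesis using assms
    by (simp only: fps_sub_nth fps_mult_left_const_nth fps_deriv_nth fps_X_mult_nth)
       (simp add: C_def algebra_simps)
qed

lemma card_Omega_pos:
  assumes "n > 0"
  shows "card (Omega n) > 0"
  using assms
proof (induction n)
  case (Suc n)
  show ?case
  proof (cases "n = 0")
    case False
    then have "(real n + 1) * real (card (Omega (Suc n))) > 0"
      using Suc by (subst card_Omega_Suc) auto
    then show ?thesis by (simp add: zero_less_mult_iff)
  qed auto
qed auto

section \<open>Generating functions of the fibres of pruning\<close>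

definition prune_fibre :: "fbtree \<Rightarrow> nat \<Rightarrow> fbtree set" where
  "prune_fibre s n = {t \<in> Omega n. t \<noteq> Leaf \<and> prune t = s}"

lemma finite_prune_fibre [simp]: "finite (prune_fibre s n)"
  by (simp add: prune_fibre_def)

lemma prune_fibre_0 [simp]: "prune_fibre s 0 = {}"
  by (simp add: prune_fibre_def)

text \<open>The trees in a fibre whose root survives pruning, or, over \<open>Leaf\<close>, the tree that contracts to it.\<close>
definition fibre_core :: "fbtree \<Rightarrow> nat \<Rightarrow> fbtree set" where
  "fibre_core s n = (case s of Leaf \<Rightarrow> if n = 2 then {Node Leaf Leaf} else {}
     | Node a b \<Rightarrow> (\<lambda>(l, r). Node l r) ` (\<Union>i\<in>{..n}. prune_fibre a i \<times> prune_fibre b (n - i)))"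

lemma fibre_core_Leaf: "fibre_core Leaf n = (if n = 2 then {Node Leaf Leaf} else {})"
  and fibre_core_Node: "fibre_core (Node a b) n =
        (\<lambda>(l, r). Node l r) ` (\<Union>i\<in>{..n}. prune_fibre a i \<times> prune_fibre b (n - i))"
  by (auto simp: fibre_core_def)

text \<open>Case distinction on which children of the root are leaves. With exactly one leaf child
  the root is contracted, and deleting that leaf gives a tree of the same fibre, one leaf
  smaller.\<close>

lemma prune_fibre_Suc:
  "prune_fibre s (Suc n) = Node Leaf ` prune_fibre s n \<union> (\<lambda>t. Node t Leaf) ` prune_fibre s n
     \<union> fibre_core s (Suc n)"
proof (intro set_eqI iffI)
  fix t assume t: "t \<in> prune_fibre s (Suc n)"
  then obtain l r where lr: "t = Node l r"
    by (cases t) (auto simp: prune_fibre_def)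
  consider "l = Leaf" "r = Leaf" | "l = Leaf" "r \<noteq> Leaf" | "l \<noteq> Leaf" "r = Leaf" | "l \<noteq> Leaf" "r \<noteq> Leaf"
    by blast
  then show "t \<in> Node Leaf ` prune_fibre s n \<union> (\<lambda>t. Node t Leaf) ` prune_fibre s n
     \<union> fibre_core s (Suc n)"
  proof cases
    case 4
    then have "(l, r) \<in> (\<Union>i\<in>{..Suc n}. prune_fibre (prune l) i \<times> prune_fibre (prune r) (Suc n - i))"
      using t lr by (intro UN_I[of "leaves l"]) (auto simp: prune_fibre_def mem_Omega)
    then have "t \<in> fibre_core (Node (prune l) (prune r)) (Suc n)"
      unfolding fibre_core_Node lr by (intro image_eqI[of _ _ "(l, r)"]) auto
    moreover have "s = Node (prune l) (prune r)"
      using t lr 4 by (simp add: prune_fibre_def)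
    ultimately have "t \<in> fibre_core s (Suc n)" by simp
    then show ?thesis by blast
  qed (use t lr in \<open>auto simp: prune_fibre_def fibre_core_def mem_Omega\<close>)
next
  fix t assume "t \<in> Node Leaf ` prune_fibre s n \<union> (\<lambda>t. Node t Leaf) ` prune_fibre s n
     \<union> fibre_core s (Suc n)"
  then show "t \<in> prune_fibre s (Suc n)"
    by (cases s) (auto simp: prune_fibre_def fibre_core_def mem_Omega split: if_splits)
qed

lemma card_prune_fibre_Suc:
  "card (prune_fibre s (Suc n)) = 2 * card (prune_fibre s n) + card (fibre_core s (Suc n))"
proof -
  have 1: "card (Node Leaf ` prune_fibre s n) = card (prune_fibre s n)"
    "card ((\<lambda>t. Node t Leaf) ` prune_fibre s n) = card (prune_fibre s n)"
    by (auto intro!: card_image simp: inj_on_def)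
  have fin: "finite (fibre_core s (Suc n))"
    by (cases s) (auto simp: fibre_core_def)
  have "card (prune_fibre s (Suc n)) = card (Node Leaf ` prune_fibre s n \<union> (\<lambda>t. Node t Leaf) ` prune_fibre s n)
     + card (fibre_core s (Suc n))"
    unfolding prune_fibre_Suc
    by (intro card_Un_disjoint fin) (cases s; auto simp: prune_fibre_def fibre_core_def split: if_splits)+
  \<comment> \<open>The two images are disjoint because a fibre never contains
    \<open>Leaf\<close>.\<close>
  also have "card (Node Leaf ` prune_fibre s n \<union> (\<lambda>t. Node t Leaf) ` prune_fibre s n)
     = card (Node Leaf ` prune_fibre s n) + card ((\<lambda>t. Node t Leaf) ` prune_fibre s n)"
    by (intro card_Un_disjoint) (auto simp: prune_fibre_def)
  finally show ?thesis using 1 by simp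
qed

lemma card_fibre_core_Node:
  "card (fibre_core (Node a b) n) = (\<Sum>i\<le>n. card (prune_fibre a i) * card (prune_fibre b (n - i)))"
proof -
  have "card (fibre_core (Node a b) n) = card (\<Union>i\<in>{..n}. prune_fibre a i \<times> prune_fibre b (n - i))"
    unfolding fibre_core_Node by (intro card_image) (auto simp: inj_on_def)
  also have "\<dots> = (\<Sum>i\<le>n. card (prune_fibre a i \<times> prune_fibre b (n - i)))"
    by (intro card_UN_disjoint) (auto, auto simp: prune_fibre_def mem_Omega)
  finally show ?thesis by (simp add: card_cartesian_product)
qed

text \<open>\<open>geo2\<close> accounts for the chains of nodes with a single leaf child, each of which is a left or a
  right child.\<close>
definition geo2 :: "real fps" where
  "geo2 = inverse (1 - fps_const 2 * fps_X)"

lemma geo2_left_inverse: "(1 - fps_const 2 * fps_X) * geo2 = 1"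
  unfolding geo2_def by (intro inverse_mult_eq_1') simp

lemma fps_eq_geo2_mult:
  assumes "(1 - fps_const 2 * fps_X) * F = G"
  shows "F = geo2 * G"
proof -
  have "geo2 * G = ((1 - fps_const 2 * fps_X) * geo2) * F"
    unfolding assms[symmetric] by (simp only: mult_ac)
  then show ?thesis by (simp add: geo2_left_inverse)
qed

lemma fps_nth_geo2_power: "fps_nth (geo2 ^ Suc j) n = 2 ^ n * real ((n + j) choose j)"
proof -
  have "geo2 ^ Suc j = Abs_fps (\<lambda>k. of_nat ((Suc j + k - 1) choose k) * 2 ^ k)"
    unfolding geo2_def fps_inverse_power[symmetric]
    by (rule one_minus_const_fps_X_neg_power') simp
  then show ?thesis
    using binomial_symmetric[of j "n + j"] by (simp add: add.commute)
qed

text \<open>A tree with \<open>m\<close> leaves has \<open>2m - 1\<close> nodes. Each node carries a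
  chain of contracted nodes, giving a factor \<open>geo2\<close>, and each leaf is what remains of a
  cherry, giving \<open>X^2\<close>. Hence the series depends on \<open>s\<close> only through
  \<open>leaves s\<close>.\<close>

lemma fps_prune_fibre:
  "Abs_fps (\<lambda>n. real (card (prune_fibre s n))) = fps_X ^ (2 * leaves s) * geo2 ^ (2 * leaves s - 1)"
proof -
  define F where "F s = Abs_fps (\<lambda>n. real (card (prune_fibre s n)))" for s
  have step: "F s = geo2 * Abs_fps (\<lambda>n. real (card (fibre_core s n)))" for s
  proof (rule fps_eq_geo2_mult, rule fps_ext)
    fix n
    have "card (fibre_core s 0) = 0"
      by (cases s) (auto simp: fibre_core_def)
    then show "fps_nth ((1 - fps_const 2 * fps_X) * F s) n = fps_nth (Abs_fps (\<lambda>n. real (card (fibre_core s n)))) n"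
      by (cases n) (simp_all add: F_def left_diff_distrib mult.assoc card_prune_fibre_Suc)
  qed
  have "F s = fps_X ^ (2 * leaves s) * geo2 ^ (2 * leaves s - 1)"
  proof (induction s)
    case Leaf
    have "Abs_fps (\<lambda>n. real (card (fibre_core Leaf n))) = fps_X ^ 2"
      by (rule fps_ext) (simp add: fibre_core_Leaf fps_X_power_nth)
    then show ?case by (subst step) (simp add: mult.commute)
  next
    case (Node a b)
    have "Abs_fps (\<lambda>n. real (card (fibre_core (Node a b) n))) = F a * F b"
      by (rule fps_ext) (simp add: card_fibre_core_Node F_def fps_mult_nth atMost_atLeast0)
    then have "F (Node a b) = geo2 * (F a * F b)" by (subst step) simp
    also have "\<dots> = fps_X ^ (2 * leaves a + 2 * leaves b) * geo2 ^ Suc ((2 * leaves a - 1) + (2 * leaves b - 1))"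
      unfolding Node by (simp add: power_add mult_ac)
    also have "Suc ((2 * leaves a - 1) + (2 * leaves b - 1)) = 2 * leaves (Node a b) - 1"
      using leaves_pos[of a] leaves_pos[of b] by (simp del: leaves_pos)
    finally show ?case by (simp add: algebra_simps)
  qed
  then show ?thesis by (simp add: F_def)
qed

text \<open>The coefficient of \<open>X^n\<close> in \<open>X^(2m) * geo2^(2m - 1)\<close>. The
  guard excludes nonzero values caused by truncated subtraction, for instance at
  \<open>m = 0\<close>.\<close>

definition fibre_size :: "nat \<Rightarrow> nat \<Rightarrow> nat" where
  "fibre_size n m = (if 0 < m \<and> 2 * m \<le> n then 2 ^ (n - 2 * m) * ((n - 2) choose (2 * m - 2)) else 0)"

lemma card_prune_fibre: "card (prune_fibre s n) = fibre_size n (leaves s)"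
proof -
  define m where "m = leaves s"
  have m: "m > 0" by (simp add: m_def)
  then obtain k where k: "m = Suc k" by (cases m) auto
  have "real (card (prune_fibre s n)) = fps_nth (Abs_fps (\<lambda>n. real (card (prune_fibre s n)))) n"
    by simp
  also have "\<dots> = fps_nth (fps_X ^ (2 * m) * geo2 ^ Suc (2 * k)) n"
    unfolding fps_prune_fibre by (simp add: k flip: m_def)
  also have "\<dots> = real (fibre_size n m)"
    unfolding fps_X_power_mult_nth fps_nth_geo2_power using k by (auto simp: fibre_size_def)
  finally show ?thesis by (simp add: m_def)
qed

text \<open>Grouping by the pruned tree. Since the fibre size depends only on \<open>m\<close>, this
  expresses that the pruned tree is uniform given its number of leaves.\<close>

lemma sum_Omega_prune:
  fixes h :: "fbtree \<Rightarrow> 'a :: real_normed_field"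
  assumes "n \<ge> 2"
  shows "(\<Sum>t\<in>Omega n. h (prune t)) = (\<Sum>m\<le>n. of_nat (fibre_size n m) * (\<Sum>s\<in>Omega m. h s))"
proof -
  have nL: "t \<noteq> Leaf" if "t \<in> Omega n" for t
    using that assms by (auto simp: mem_Omega)
  have le: "leaves (prune t) \<le> n" if "t \<in> Omega n" for t
    using leaves_prune[OF nL[OF that]] that by (simp add: mem_Omega)
  have "(\<Sum>t\<in>Omega n. h (prune t)) = (\<Sum>s\<in>(\<Union>m\<in>{..n}. Omega m). \<Sum>t\<in>{t\<in>Omega n. prune t = s}. h (prune t))"
    using le by (intro sum.group[symmetric]) (auto simp: mem_Omega)
  also have "\<dots> = (\<Sum>s\<in>(\<Union>m\<in>{..n}. Omega m). of_nat (fibre_size n (leaves s)) * h s)"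
  proof (intro sum.cong refl)
    fix s
    have "{t\<in>Omega n. prune t = s} = prune_fibre s n"
      using nL by (auto simp: prune_fibre_def)
    then show "(\<Sum>t\<in>{t\<in>Omega n. prune t = s}. h (prune t)) = of_nat (fibre_size n (leaves s)) * h s"
      by (simp add: prune_fibre_def flip: card_prune_fibre)
  qed
  also have "\<dots> = (\<Sum>m\<le>n. \<Sum>s\<in>Omega m. of_nat (fibre_size n (leaves s)) * h s)"
    by (intro sum.UNION_disjoint) (auto simp: mem_Omega)
  also have "\<dots> = (\<Sum>m\<le>n. of_nat (fibre_size n m) * (\<Sum>s\<in>Omega m. h s))"
    by (intro sum.cong refl) (simp add: sum_distrib_left mem_Omega)
  finally show ?thesis .
qed

section \<open>The ratio of consecutive weights and the Stein identity\<close>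

text \<open>Two absorption steps for the binomial coefficient and a factor 4 from the power of two.
  With denominators cleared it also holds at the boundary: for \<open>m = 0\<close>,
  \<open>n = 2m\<close> or \<open>n = 2m + 1\<close> both sides vanish.\<close>

lemma fibre_size_Suc:
  "4 * (2 * real m * (2 * real m - 1)) * real (fibre_size n (Suc m))
     = (real n - 2 * real m) * (real n - 2 * real m - 1) * real (fibre_size n m)"
proof (cases "m > 0 \<and> 2 * m + 2 \<le> n")
  case True
  define N j where "N = n - 2" and "j = 2 * m - 2"
  have nj: "n = N + 2" "2 * m = j + 2" "j + 2 \<le> N" "n - 2 * m = Suc (Suc (N - Suc (Suc j)))"
    "n - 2 * Suc m = N - Suc (Suc j)"
    using True by (auto simp: N_def j_def)
  have ch: "real (N choose Suc i) * real (Suc i) = real (N - i) * real (N choose i)" for i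
    unfolding of_nat_mult[symmetric]
    by (metis binomial_absorb_comp binomial_absorption mult.commute)
  have choose_eq: "real (N choose Suc (Suc j)) * real (Suc (Suc j)) * real (Suc j)
      = real (N - Suc j) * real (N - j) * real (N choose j)"
    using ch[of j] ch[of "Suc j"] by (simp add: mult_ac)
  have "real (fibre_size n (Suc m)) = 2 ^ (N - Suc (Suc j)) * real (N choose Suc (Suc j))"
  proof -
    have "fibre_size n (Suc m) = 2 ^ (n - 2 * Suc m) * (N choose (2 * Suc m - 2))"
      using True by (simp add: fibre_size_def N_def)
    moreover have "2 * Suc m - 2 = Suc (Suc j)" using nj by simp
    ultimately show ?thesis unfolding nj(5) by simp
  qed
  moreover have "real (fibre_size n m) = 4 * 2 ^ (N - Suc (Suc j)) * real (N choose j)"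
  proof -
    have "fibre_size n m = 2 ^ (n - 2 * m) * (N choose j)"
      using True by (simp add: fibre_size_def N_def j_def)
    then show ?thesis unfolding nj(4) by simp
  qed
  moreover have "2 * real m = real (Suc (Suc j))" "2 * real m - 1 = real (Suc j)"
    "real n - 2 * real m = real (N - j)" "real n - 2 * real m - 1 = real (N - Suc j)"
    using nj True by (auto simp: of_nat_diff)
  ultimately have "4 * (2 * real m * (2 * real m - 1)) * real (fibre_size n (Suc m))
      = 4 * 2 ^ (N - Suc (Suc j)) * (real (N choose Suc (Suc j)) * real (Suc (Suc j)) * real (Suc j))"
    "(real n - 2 * real m) * (real n - 2 * real m - 1) * real (fibre_size n m)
      = 4 * 2 ^ (N - Suc (Suc j)) * (real (N - Suc j) * real (N - j) * real (N choose j))"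
    by (simp_all only: mult_ac)
  then show ?thesis unfolding choose_eq by simp
next
  case False
  show ?thesis
  proof (cases "m > 0 \<and> 2 * m \<le> n")
    case True
    then have "n = 2 * m \<or> n = 2 * m + 1" using False by auto
    then show ?thesis using False by (auto simp: fibre_size_def)
  next
    case F: False
    then show ?thesis by (auto simp: fibre_size_def)
  qed
qed

definition prune_weight :: "nat \<Rightarrow> nat \<Rightarrow> real" where
  "prune_weight n m = real (fibre_size n m) * real (card (Omega m))"

text \<open>The ratio of fibre sizes times the ratio of tree counts; the factor
  \<open>2m - 1\<close> cancels between the two.\<close>

lemma prune_weight_Suc:
  "4 * real m * (real m + 1) * prune_weight n (Suc m)
     = (real n - 2 * real m) * (real n - 2 * real m - 1) * prune_weight n m"
proof (cases "m = 0")
  case False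
  have "(real m + 1) * real (card (Omega (Suc m))) = 2 * (2 * real m - 1) * real (card (Omega m))"
    using card_Omega_Suc[of m] False by (simp add: algebra_simps)
  note eq = this
  have "4 * real m * (real m + 1) * prune_weight n (Suc m)
     = 4 * real m * real (fibre_size n (Suc m)) * ((real m + 1) * real (card (Omega (Suc m))))"
    unfolding prune_weight_def by (simp only: mult_ac)
  also have "\<dots> = 4 * real m * real (fibre_size n (Suc m)) * (2 * (2 * real m - 1) * real (card (Omega m)))"
    unfolding eq ..
  also have "\<dots> = (4 * (2 * real m * (2 * real m - 1)) * real (fibre_size n (Suc m))) * real (card (Omega m))"
    by (simp add: mult_ac)
  finally show ?thesis unfolding fibre_size_Suc prune_weight_def by (simp add: mult_ac)
qed (simp add: prune_weight_def)

lemma sum_Omega_leaves_prune: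
  fixes g :: "nat \<Rightarrow> 'a :: real_normed_field"
  assumes "n \<ge> 2"
  shows "(\<Sum>t\<in>Omega n. g (leaves (prune t))) = (\<Sum>m\<le>n. of_real (prune_weight n m) * g m)"
  using sum_Omega_prune[OF assms, of "\<lambda>s. g (leaves s)"]
  by (simp add: prune_weight_def mem_Omega mult.assoc)

lemma sum_Omega_stein:
  fixes f :: "nat \<Rightarrow> 'a :: real_normed_field"
  assumes "n \<ge> 2"
  defines "M \<equiv> \<lambda>t. leaves (prune t)"
  shows "(\<Sum>t\<in>Omega n. of_real ((real n - 2 * real (M t)) * (real n - 2 * real (M t) - 1)) * f (Suc (M t)))
       = (\<Sum>t\<in>Omega n. of_real (4 * real (M t) * (real (M t) - 1)) * f (M t))"
proof -
  define w where "w = prune_weight n"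
  have wn: "w (Suc n) = 0" "w 0 = 0" by (auto simp: w_def prune_weight_def fibre_size_def)
  have "(\<Sum>t\<in>Omega n. of_real ((real n - 2 * real (M t)) * (real n - 2 * real (M t) - 1)) * f (Suc (M t)))
      = (\<Sum>m\<le>n. of_real (w m) * (of_real ((real n - 2 * real m) * (real n - 2 * real m - 1)) * f (Suc m)))"
    unfolding M_def w_def by (subst sum_Omega_leaves_prune[OF assms(1), symmetric]) simp
  also have "\<dots> = (\<Sum>m\<le>n. of_real (4 * real m * (real m + 1) * w (Suc m)) * f (Suc m))"
    unfolding w_def prune_weight_Suc by (intro sum.cong refl) (simp add: mult_ac)
  \<comment> \<open>Index shift. The new term at 0 vanishes through the factor
    \<open>real m\<close>, and the top term is dropped next because
    \<open>w (Suc n) = 0\<close>.\<close>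
  also have "\<dots> = (\<Sum>m\<le>Suc n. of_real (4 * (real m - 1) * real m * w m) * f m)"
    by (subst sum.atMost_Suc_shift) (simp add: algebra_simps)
  also have "\<dots> = (\<Sum>m\<le>n. of_real (w m) * (of_real (4 * real m * (real m - 1)) * f m))"
    using wn by (simp add: mult_ac)
  also have "\<dots> = (\<Sum>t\<in>Omega n. of_real (4 * real (M t) * (real (M t) - 1)) * f (M t))"
    unfolding M_def w_def by (subst sum_Omega_leaves_prune[OF assms(1), symmetric]) simp
  finally show ?thesis .
qed

subsection \<open>Moments of the number of leaves after pruning\<close>

text \<open>The expectation under \<open>P n\<close> as a finite sum, with values in any normed
  field so that it covers both real moments and characteristic functions.\<close>

definition mean :: "nat \<Rightarrow> (fbtree \<Rightarrow> 'a) \<Rightarrow> 'a :: real_normed_field" where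
  "mean n h = (\<Sum>t\<in>Omega n. h t) / of_nat (card (Omega n))"

lemma mean_Suc_0 [simp]: "mean (Suc 0) h = h Leaf"
  by (simp add: mean_def)

lemma mean_const: "n > 0 \<Longrightarrow> mean n (\<lambda>t. c) = c"
  using card_Omega_pos[of n] by (auto simp: mean_def)

lemma mean_add: "mean n (\<lambda>t. f t + g t) = mean n f + mean n g"
  by (simp add: mean_def sum.distrib add_divide_distrib)

lemma mean_diff: "mean n (\<lambda>t. f t - g t) = mean n f - mean n g"
  by (simp add: mean_def sum_subtractf diff_divide_distrib)

lemma mean_mult_left: "mean n (\<lambda>t. c * f t) = c * mean n f"
  by (simp add: mean_def sum_distrib_left)

lemma mean_cong: "(\<And>t. t \<in> Omega n \<Longrightarrow> f t = g t) \<Longrightarrow> mean n f = mean n g"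
  by (simp add: mean_def)

lemma mean_mono:
  fixes f g :: "fbtree \<Rightarrow> real"
  shows "(\<And>t. t \<in> Omega n \<Longrightarrow> f t \<le> g t) \<Longrightarrow> mean n f \<le> mean n g"
  unfolding mean_def by (intro divide_right_mono sum_mono) auto

lemma norm_mean_le: "norm (mean n f) \<le> mean n (\<lambda>t. norm (f t))"
  unfolding mean_def norm_divide norm_of_nat by (intro divide_right_mono norm_sum) auto

lemma norm_mean_le_bound:
  assumes "n > 0" "\<And>t. t \<in> Omega n \<Longrightarrow> norm (f t) \<le> K"
  shows "norm (mean n f) \<le> K"
proof -
  have "norm (mean n f) \<le> mean n (\<lambda>t. norm (f t))" by (rule norm_mean_le)
  also have "\<dots> \<le> mean n (\<lambda>t. K)" by (intro mean_mono assms)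
  finally show ?thesis using assms(1) by (simp add: mean_const)
qed

text \<open>The tower property: given its number of leaves the pruned tree is uniform, so
  \<open>h\<close> may be replaced by its average over trees of that size.\<close>

lemma mean_prune:
  assumes "n \<ge> 2"
  shows "mean n (\<lambda>t. h (prune t)) = mean n (\<lambda>t. mean (leaves (prune t)) h)"
proof -
  have mean_eq: "(\<Sum>s\<in>Omega m. h s) = (\<Sum>s\<in>Omega m. mean (leaves s) h)" for m
    by (cases "m = 0") (use card_Omega_pos[of m] in \<open>auto simp: mean_def mem_Omega\<close>)
  have "(\<Sum>t\<in>Omega n. h (prune t)) = (\<Sum>m\<le>n. of_nat (fibre_size n m) * (\<Sum>s\<in>Omega m. h s))"
    by (rule sum_Omega_prune[OF assms])
  also have "\<dots> = (\<Sum>m\<le>n. of_nat (fibre_size n m) * (\<Sum>s\<in>Omega m. mean (leaves s) h))"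
    by (subst mean_eq) (rule refl)
  also have "(\<Sum>m\<le>n. of_nat (fibre_size n m) * (\<Sum>s\<in>Omega m. mean (leaves s) h))
      = (\<Sum>t\<in>Omega n. mean (leaves (prune t)) h)"
    by (rule sum_Omega_prune[OF assms, symmetric])
  finally show ?thesis by (simp add: mean_def)
qed

text \<open>The variable \<open>Y\<close> of the overview. The centre \<open>n/4\<close> is the mean
  up to a bounded term: the Stein identity with \<open>f = 1\<close> gives the exact mean
  \<open>n(n - 1)/(4n - 6)\<close>.\<close>

definition dev :: "nat \<Rightarrow> fbtree \<Rightarrow> real" where
  "dev n t = real (leaves (prune t)) - real n / 4"

lemma leaves_prune_le:
  assumes "n \<ge> 2" "t \<in> Omega n"
  shows "2 * leaves (prune t) \<le> n"
  using leaves_prune[of t] assms by (cases t) (auto simp: mem_Omega)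

lemma abs_dev_le:
  assumes "n \<ge> 2" "t \<in> Omega n"
  shows "\<bar>dev n t\<bar> \<le> real n / 4"
  using leaves_prune_le[OF assms] leaves_pos[of "prune t"] unfolding dev_def abs_le_iff
  by linarith

lemma mean_stein:
  fixes g :: "real \<Rightarrow> 'a :: real_normed_field"
  assumes "n \<ge> 2"
  defines "A \<equiv> \<lambda>t. (real n / 2 - 2 * dev n t) * (real n / 2 - 2 * dev n t - 1)"
    and "B \<equiv> \<lambda>t. (real n / 2 + 2 * dev n t) * (real n / 2 + 2 * dev n t - 2)"
  shows "mean n (\<lambda>t. of_real (A t) * g (dev n t + 1)) = mean n (\<lambda>t. of_real (B t) * g (dev n t))"
proof -
  have *: "real (Suc (leaves (prune t))) - real n / 4 = dev n t + 1"
    "real n - 2 * real (leaves (prune t)) = real n / 2 - 2 * dev n t"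
    "4 * real (leaves (prune t)) * (real (leaves (prune t)) - 1) = B t" for t
    by (simp_all add: dev_def B_def algebra_simps)
  show ?thesis
    using sum_Omega_stein[OF assms(1), of "\<lambda>m. g (real m - real n / 4)"]
    unfolding mean_def * dev_def[symmetric] A_def by simp
qed

text \<open>The Stein identity with \<open>g\<close> the identity. The coefficient
  \<open>4n - 10\<close> of the second moment is positive only from \<open>n = 3\<close> on, so
  \<open>n = 2\<close> is bounded directly.\<close>

lemma mean_dev_square_le:
  assumes "n \<ge> 2"
  shows "mean n (\<lambda>t. (dev n t)\<^sup>2) \<le> real n"
proof (cases "n = 2")
  case True
  have "(dev n t)\<^sup>2 \<le> real n" if "t \<in> Omega n" for t
  proof -
    have "\<bar>dev n t\<bar> \<le> 1" using abs_dev_le[OF assms that] True by simp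
    then have "(dev n t)\<^sup>2 \<le> 1" by (simp add: abs_square_le_1)
    then show ?thesis using True by simp
  qed
  then have "mean n (\<lambda>t. (dev n t)\<^sup>2) \<le> mean n (\<lambda>t. real n)" by (intro mean_mono)
  then show ?thesis using assms by (simp add: mean_const)
next
  case False
  then have n: "real n \<ge> 3" using assms by simp
  define x where "x = real n"
  have "0 = mean n (\<lambda>t. (x / 2 - 2 * dev n t) * (x / 2 - 2 * dev n t - 1) * (dev n t + 1)
      - (x / 2 + 2 * dev n t) * (x / 2 + 2 * dev n t - 2) * dev n t)"
    using mean_stein[OF assms, of "\<lambda>y. y"] unfolding mean_diff x_def by simp
  also have "\<dots> \<le> mean n (\<lambda>t. 5 / 8 * x\<^sup>2 - (4 * x - 10) * (dev n t)\<^sup>2)"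
  proof (intro mean_mono)
    fix t assume t: "t \<in> Omega n"
    define y where "y = dev n t"
    have y: "\<bar>y\<bar> \<le> x / 4" unfolding y_def x_def by (rule abs_dev_le[OF assms t])
    \<comment> \<open>The cubic terms in \<open>y\<close> cancel.\<close>
    have "(x / 2 - 2 * y) * (x / 2 - 2 * y - 1) * (y + 1) - (x / 2 + 2 * y) * (x / 2 + 2 * y - 2) * y
        = x\<^sup>2 / 4 - x / 2 + (2 - 3 / 2 * x) * y - (4 * x - 10) * y\<^sup>2"
      by (simp add: field_simps power2_eq_square power3_eq_cube)
    \<comment> \<open>The bound equals \<open>3/8 * x^2\<close>; together with
      \<open>x^2 / 4\<close> it makes the constant \<open>5/8\<close>.\<close>
    moreover have "(2 - 3 / 2 * x) * y \<le> (3 / 2 * x) * (x / 4)"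
    proof -
      have "(2 - 3 / 2 * x) * y \<le> \<bar>2 - 3 / 2 * x\<bar> * \<bar>y\<bar>" by (metis abs_ge_self abs_mult)
      also have "\<dots> \<le> (3 / 2 * x) * (x / 4)" using y n by (intro mult_mono) (auto simp: x_def)
      finally show ?thesis .
    qed
    moreover have "x \<ge> 0" by (simp add: x_def)
    ultimately show "(x / 2 - 2 * dev n t) * (x / 2 - 2 * dev n t - 1) * (dev n t + 1)
      - (x / 2 + 2 * dev n t) * (x / 2 + 2 * dev n t - 2) * dev n t
      \<le> 5 / 8 * x\<^sup>2 - (4 * x - 10) * (dev n t)\<^sup>2"
      unfolding y_def[symmetric] by (simp add: power2_eq_square)
  qed
  also have "\<dots> = 5 / 8 * x\<^sup>2 - (4 * x - 10) * mean n (\<lambda>t. (dev n t)\<^sup>2)"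
    using assms by (simp add: mean_diff mean_const mean_mult_left)
  finally have "(4 * x - 10) * mean n (\<lambda>t. (dev n t)\<^sup>2) \<le> 5 / 8 * x\<^sup>2" by simp
  also have "\<dots> \<le> (4 * x - 10) * x"
  proof -
    have "5 / 8 * x \<le> 4 * x - 10" using n by (simp add: x_def)
    then have "5 / 8 * x * x \<le> (4 * x - 10) * x" using n by (intro mult_right_mono) (auto simp: x_def)
    then show ?thesis by (simp add: power2_eq_square)
  qed
  finally show ?thesis using n by (simp add: x_def)
qed

text \<open>Cauchy-Schwarz in pointwise form: the arithmetic-geometric mean inequality with weight
  \<open>q = sqrt n\<close>, then averaging.\<close>

lemma mean_abs_dev_le:
  assumes "n \<ge> 2"
  shows "mean n (\<lambda>t. \<bar>dev n t\<bar>) \<le> sqrt (real n)"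
proof -
  define q where "q = sqrt (real n)"
  have q: "q > 0" "q\<^sup>2 = real n" using assms by (auto simp: q_def)
  have "\<bar>y\<bar> \<le> q / 2 + 1 / (2 * q) * y\<^sup>2" for y :: real
  proof -
    have "0 \<le> (q - \<bar>y\<bar>)\<^sup>2" by simp
    then have "2 * q * \<bar>y\<bar> \<le> q\<^sup>2 + y\<^sup>2" by (simp add: power2_diff)
    then show ?thesis using q(1) by (simp add: field_simps power2_eq_square)
  qed
  then have "mean n (\<lambda>t. \<bar>dev n t\<bar>) \<le> mean n (\<lambda>t. q / 2 + 1 / (2 * q) * (dev n t)\<^sup>2)"
    by (intro mean_mono)
  also have "\<dots> = q / 2 + 1 / (2 * q) * mean n (\<lambda>t. (dev n t)\<^sup>2)"
    using assms by (simp only: mean_add mean_mult_left) (simp add: mean_const)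
  also have "\<dots> \<le> q / 2 + 1 / (2 * q) * q\<^sup>2"
    using mean_dev_square_le[OF assms] q by (intro add_left_mono mult_left_mono) auto
  also have "\<dots> = q" using q(1) by (simp add: power2_eq_square)
  finally show ?thesis by (simp add: q_def)
qed

lemma norm_iexp [simp]: "norm (iexp x) = 1"
  by simp

lemma norm_iexp_minus_one_le: "norm (iexp x - 1) \<le> \<bar>x\<bar>"
  using iexp_approx1[of x 0] by simp

subsection \<open>Gaussian approximation of the characteristic function\<close>

text \<open>Integrating factor: the derivative of \<open>\<psi> x * exp (a * x^2)\<close> is the
  residual times that factor. The mean value inequality bounds the increment from 0 to
  \<open>\<theta>\<close>, and multiplying back cancels the exponentials, so the bound does not
  depend on \<open>a\<close>.\<close>

lemma gaussian_ode_stability: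
  fixes \<psi> :: "real \<Rightarrow> complex"
  assumes deriv: "\<And>x. (\<psi> has_vector_derivative \<psi>' x) (at x)"
    and init: "\<psi> 0 = 1" and a: "a \<ge> 0"
    and bound: "\<And>x. \<bar>x\<bar> \<le> \<bar>\<theta>\<bar> \<Longrightarrow> norm (\<psi>' x + of_real (2 * a * x) * \<psi> x) \<le> K"
  shows "norm (\<psi> \<theta> - of_real (exp (- a * \<theta>\<^sup>2))) \<le> K * \<bar>\<theta>\<bar>"
proof -
  define F where "F x = \<psi> x * of_real (exp (a * x\<^sup>2))" for x
  define F' where "F' x = (\<psi>' x + of_real (2 * a * x) * \<psi> x) * of_real (exp (a * x\<^sup>2))" for x
  have F: "(F has_vector_derivative F' x) (at x)" for x
  proof -
    have "((\<lambda>x. exp (a * x\<^sup>2)) has_real_derivative exp (a * x\<^sup>2) * (2 * a * x)) (at x)"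
      by (auto intro!: derivative_eq_intros)
    then have "((\<lambda>x. complex_of_real (exp (a * x\<^sup>2))) has_vector_derivative
        complex_of_real (exp (a * x\<^sup>2) * (2 * a * x))) (at x)"
      by (intro has_vector_derivative_of_real) (simp add: has_real_derivative_iff_has_vector_derivative)
    from has_vector_derivative_mult[OF deriv this] show ?thesis
      unfolding F_def F'_def by (rule has_vector_derivative_eq_rhs) (simp add: algebra_simps)
  qed
  have "norm (F \<theta> - F 0) \<le> (K * exp (a * \<theta>\<^sup>2)) * norm (\<theta> - 0)"
  proof (rule differentiable_bound)
    show "convex (cball 0 \<bar>\<theta>\<bar> :: real set)" by simp
    show "(F has_derivative (\<lambda>h. h *\<^sub>R F' x)) (at x within cball 0 \<bar>\<theta>\<bar>)" for x
      using F[of x] unfolding has_vector_derivative_def by (rule has_derivative_at_withinI)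
  next
    fix x :: real assume "x \<in> cball 0 \<bar>\<theta>\<bar>"
    then have x: "\<bar>x\<bar> \<le> \<bar>\<theta>\<bar>" by simp
    have "norm (F' x) = norm (\<psi>' x + of_real (2 * a * x) * \<psi> x) * exp (a * x\<^sup>2)"
      by (simp add: F'_def norm_mult)
    also have "\<dots> \<le> K * exp (a * \<theta>\<^sup>2)"
      using bound[OF x] a x norm_ge_zero[THEN order_trans, OF bound[OF x]]
      by (intro mult_mono) (auto simp: abs_le_square_iff intro!: mult_left_mono)
    finally show "onorm (\<lambda>h. h *\<^sub>R F' x) \<le> K * exp (a * \<theta>\<^sup>2)"
      using onorm_scaleR_left[of "\<lambda>h::real. h" "F' x"] by (simp add: onorm_id[unfolded id_def])
  qed auto
  then have bd: "norm (F \<theta> - 1) \<le> K * exp (a * \<theta>\<^sup>2) * \<bar>\<theta>\<bar>" by (simp add: F_def init)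
  have "\<psi> \<theta> - of_real (exp (- a * \<theta>\<^sup>2)) = (F \<theta> - 1) * of_real (exp (- a * \<theta>\<^sup>2))"
    unfolding F_def by (simp add: algebra_simps flip: of_real_mult exp_add)
  then have "norm (\<psi> \<theta> - of_real (exp (- a * \<theta>\<^sup>2))) = norm (F \<theta> - 1) * exp (- a * \<theta>\<^sup>2)"
    by (simp add: norm_mult)
  also have "\<dots> \<le> K * exp (a * \<theta>\<^sup>2) * \<bar>\<theta>\<bar> * exp (- a * \<theta>\<^sup>2)"
    using bd by (intro mult_right_mono) auto
  also have "\<dots> = K * \<bar>\<theta>\<bar> * (exp (a * \<theta>\<^sup>2) * exp (- a * \<theta>\<^sup>2))" by (simp only: mult_ac)
  also have "exp (a * \<theta>\<^sup>2) * exp (- a * \<theta>\<^sup>2) = 1" by (simp flip: exp_add)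
  finally show ?thesis by simp
qed

text \<open>Isolates the part of the Stein coefficient that forms the differential equation. For
  \<open>|x| sqrt n\<close> bounded the mean of the remainder is of order \<open>n\<close>, hence
  bounded after division by \<open>4n\<close>.\<close>

lemma stein_remainder_bound:
  assumes "n \<ge> 2" "t \<in> Omega n"
  defines "A \<equiv> (real n / 2 - 2 * dev n t) * (real n / 2 - 2 * dev n t - 1)"
    and "B \<equiv> (real n / 2 + 2 * dev n t) * (real n / 2 + 2 * dev n t - 2)"
  shows "norm (of_real A * iexp x - of_real B - (of_real (- 4 * real n * dev n t) + \<i> * of_real (x * (real n)\<^sup>2 / 4)))
    \<le> real n / 2 + \<bar>x\<bar> * (real n / 2) + (real n)\<^sup>2 * x\<^sup>2 / 2 + (6 + \<bar>x\<bar> * (3 * real n + 2)) * \<bar>dev n t\<bar>"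
proof -
  define y N where "y = dev n t" and "N = real n"
  have y: "\<bar>y\<bar> \<le> N / 4" unfolding y_def N_def by (rule abs_dev_le[OF assms(1,2)])
  have N: "N \<ge> 2" using assms by (simp add: N_def)
  define u where "u = iexp x - 1 - \<i> * of_real x"
  have u: "norm u \<le> x\<^sup>2 / 2" using iexp_approx1[of x 1] by (simp add: u_def algebra_simps power2_eq_square)
  \<comment> \<open>The squares of \<open>y\<close> cancel in \<open>A - B\<close>, while
    \<open>A\<close> alone is multiplied by \<open>x\<close> and only its leading term
    \<open>N^2 / 4\<close> is kept.\<close>
  have AB: "A - B = - 4 * N * y + (N / 2 + 6 * y)" "A = N\<^sup>2 / 4 + (- 2 * N * y + 4 * y\<^sup>2 - N / 2 + 2 * y)"
    by (simp_all add: A_def B_def y_def[symmetric] N_def[symmetric] field_simps power2_eq_square)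
  have "of_real A * iexp x - of_real B = of_real (A - B) + \<i> * of_real (x * A) + of_real A * u"
    by (simp add: u_def algebra_simps)
  also have "\<dots> - (of_real (- 4 * N * y) + \<i> * of_real (x * N\<^sup>2 / 4))
     = of_real (N / 2 + 6 * y) + \<i> * of_real (x * (- 2 * N * y + 4 * y\<^sup>2 - N / 2 + 2 * y)) + of_real A * u"
    unfolding AB(1) unfolding AB(2) by (simp add: algebra_simps)
  finally have "norm (of_real A * iexp x - of_real B - (of_real (- 4 * N * y) + \<i> * of_real (x * N\<^sup>2 / 4)))
     \<le> norm (of_real (N / 2 + 6 * y) :: complex) + norm (\<i> * of_real (x * (- 2 * N * y + 4 * y\<^sup>2 - N / 2 + 2 * y)))
        + norm (of_real A * u)"
    using norm_triangle_ineq norm_triangle_le by (smt (verit))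
  also have "\<dots> = \<bar>N / 2 + 6 * y\<bar> + \<bar>x\<bar> * \<bar>- 2 * N * y + 4 * y\<^sup>2 - N / 2 + 2 * y\<bar> + \<bar>A\<bar> * norm u"
    by (simp only: norm_mult norm_of_real abs_mult norm_ii mult_1)
  also have "\<dots> \<le> (N / 2 + 6 * \<bar>y\<bar>) + \<bar>x\<bar> * (3 * N * \<bar>y\<bar> + N / 2 + 2 * \<bar>y\<bar>) + N\<^sup>2 * (x\<^sup>2 / 2)"
  proof (intro add_mono mult_left_mono mult_mono u)
    show "\<bar>N / 2 + 6 * y\<bar> \<le> N / 2 + 6 * \<bar>y\<bar>" using N by linarith
    \<comment> \<open>Trading one factor \<open>|y|\<close> for \<open>N / 4\<close> leaves a bound
      linear in \<open>|y|\<close>.\<close>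
    have "4 * y\<^sup>2 = (4 * \<bar>y\<bar>) * \<bar>y\<bar>" by (simp add: power2_eq_square)
    also have "\<dots> \<le> N * \<bar>y\<bar>" using y by (intro mult_right_mono) auto
    finally have "4 * y\<^sup>2 \<le> N * \<bar>y\<bar>" .
    moreover have "\<bar>- 2 * N * y\<bar> = 2 * (N * \<bar>y\<bar>)" using N by (simp add: abs_mult)
    moreover have "y\<^sup>2 \<ge> 0" by simp
    ultimately show "\<bar>- 2 * N * y + 4 * y\<^sup>2 - N / 2 + 2 * y\<bar> \<le> 3 * N * \<bar>y\<bar> + N / 2 + 2 * \<bar>y\<bar>"
      using N by linarith
    have "\<bar>A\<bar> = \<bar>N / 2 - 2 * y\<bar> * \<bar>N / 2 - 2 * y - 1\<bar>"
      by (simp add: A_def abs_mult y_def N_def)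
    also have "\<dots> \<le> N * N" using y N by (intro mult_mono) linarith+
    finally show "\<bar>A\<bar> \<le> N\<^sup>2" by (simp add: power2_eq_square)
  qed auto
  also have "\<dots> = N / 2 + \<bar>x\<bar> * (N / 2) + N\<^sup>2 * x\<^sup>2 / 2 + (6 + \<bar>x\<bar> * (3 * N + 2)) * \<bar>y\<bar>"
    by (simp add: algebra_simps)
  finally show ?thesis unfolding y_def N_def .
qed

text \<open>\<open>4N\<close> times the residual is \<open>- \<i>\<close> times the mean of
  \<open>L t * e t\<close>. By the Stein identity this mean equals minus the mean of the remainder,
  which is then estimated.\<close>

lemma mean_iexp_dev_ode:
  assumes n: "n \<ge> 2" and T: "\<bar>x\<bar> * sqrt (real n) \<le> T"
  shows "norm (mean n (\<lambda>t. \<i> * of_real (dev n t) * iexp (x * dev n t))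
            + of_real (2 * (real n / 32) * x) * mean n (\<lambda>t. iexp (x * dev n t))) \<le> 2 + 2 * T + T\<^sup>2"
    (is "norm ?E \<le> _")
proof -
  define N q where "N = real n" and "q = sqrt N"
  have N: "N \<ge> 2" and q: "q \<ge> 1" "q * q = N" "q \<le> N"
  proof -
    show "N \<ge> 2" using n by (simp add: N_def)
    then show "q \<ge> 1" "q * q = N" by (auto simp: q_def)
    then show "q \<le> N" using mult_left_mono[of 1 q q] by simp
  qed
  have T': "\<bar>x\<bar> * q \<le> T" "\<bar>x\<bar> \<le> T" "T \<ge> 0"
  proof -
    show 1: "\<bar>x\<bar> * q \<le> T" using T by (simp add: q_def N_def)
    have "\<bar>x\<bar> * 1 \<le> \<bar>x\<bar> * q" using q by (intro mult_left_mono) auto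
    with 1 show "\<bar>x\<bar> \<le> T" by simp
    then show "T \<ge> 0" by linarith
  qed
  define A B where "A t = (N / 2 - 2 * dev n t) * (N / 2 - 2 * dev n t - 1)"
    and "B t = (N / 2 + 2 * dev n t) * (N / 2 + 2 * dev n t - 2)" for t
  define L where "L t = complex_of_real (- 4 * N * dev n t) + \<i> * of_real (x * N\<^sup>2 / 4)" for t
  define e where "e t = iexp (x * dev n t)" for t
  have "mean n (\<lambda>t. of_real (A t) * iexp (x * (dev n t + 1))) = mean n (\<lambda>t. of_real (B t) * iexp (x * dev n t))"
    unfolding A_def B_def N_def by (rule mean_stein[OF n])
  then have "mean n (\<lambda>t. of_real (A t) * iexp (x * (dev n t + 1)) - of_real (B t) * e t) = 0"
    by (simp add: mean_diff e_def)
  moreover have "iexp (x * (dev n t + 1)) = iexp x * e t" for t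
    by (simp add: e_def distrib_left exp_add mult.commute)
  ultimately have stein: "mean n (\<lambda>t. (of_real (A t) * iexp x - of_real (B t)) * e t) = 0"
    by (simp add: algebra_simps)
  have "of_real (4 * N) * ?E = - \<i> * mean n (\<lambda>t. L t * e t)"
    unfolding e_def[symmetric] mean_mult_left[symmetric] mean_add[symmetric]
    by (intro mean_cong) (simp add: L_def N_def algebra_simps power2_eq_square)
  also have "mean n (\<lambda>t. L t * e t) = - mean n (\<lambda>t. (of_real (A t) * iexp x - of_real (B t) - L t) * e t)"
    using stein by (simp add: left_diff_distrib[of _ "L _"] mean_diff)
  finally have "norm (of_real (4 * N) * ?E) = norm (mean n (\<lambda>t. (of_real (A t) * iexp x - of_real (B t) - L t) * e t))"
    by (simp add: norm_mult)
  then have "4 * N * norm ?E = norm (mean n (\<lambda>t. (of_real (A t) * iexp x - of_real (B t) - L t) * e t))"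
    using N by (simp only: norm_mult norm_of_real)
  also have "\<dots> \<le> mean n (\<lambda>t. norm ((of_real (A t) * iexp x - of_real (B t) - L t) * e t))"
    by (rule norm_mean_le)
  also have "\<dots> \<le> mean n (\<lambda>t. (N / 2 + \<bar>x\<bar> * (N / 2) + N\<^sup>2 * x\<^sup>2 / 2) + (6 + \<bar>x\<bar> * (3 * N + 2)) * \<bar>dev n t\<bar>)"
  proof (intro mean_mono)
    fix t assume "t \<in> Omega n"
    from stein_remainder_bound[OF n this, of x]
    show "norm ((of_real (A t) * iexp x - of_real (B t) - L t) * e t)
      \<le> (N / 2 + \<bar>x\<bar> * (N / 2) + N\<^sup>2 * x\<^sup>2 / 2) + (6 + \<bar>x\<bar> * (3 * N + 2)) * \<bar>dev n t\<bar>"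
      by (simp only: norm_mult e_def norm_iexp A_def B_def L_def N_def mult_1_right)
  qed
  also have "\<dots> = (N / 2 + \<bar>x\<bar> * (N / 2) + N\<^sup>2 * x\<^sup>2 / 2) + (6 + \<bar>x\<bar> * (3 * N + 2)) * mean n (\<lambda>t. \<bar>dev n t\<bar>)"
    using n by (simp only: mean_add mean_mult_left) (simp add: mean_const)
  also have "\<dots> \<le> (N / 2 + \<bar>x\<bar> * (N / 2) + N\<^sup>2 * x\<^sup>2 / 2) + (6 + \<bar>x\<bar> * (3 * N + 2)) * q"
    using mean_abs_dev_le[OF n] N by (intro add_left_mono mult_left_mono) (auto simp: q_def N_def)
  \<comment> \<open>By \<open>q * q = N\<close>, both the quadratic term in \<open>x\<close> and the
    term with the factor \<open>q\<close> are expressed through \<open>|x| * q\<close>, which is at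
    most \<open>T\<close>.\<close>
  also have "\<dots> = N / 2 + \<bar>x\<bar> * (N / 2) + N * (\<bar>x\<bar> * q)\<^sup>2 / 2 + 6 * q + (3 * N + 2) * (\<bar>x\<bar> * q)"
    by (simp add: algebra_simps power2_eq_square flip: q(2))
  also have "\<dots> \<le> N / 2 + T * (N / 2) + N * T\<^sup>2 / 2 + 6 * N + (3 * N + 2 * N) * T"
    using N q T' by (intro add_mono mult_mono divide_right_mono power_mono mult_left_mono) auto
  also have "\<dots> \<le> 4 * N * (2 + 2 * T + T\<^sup>2)"
  proof -
    have "0 \<le> N * T" "0 \<le> N * T\<^sup>2" using N T' by auto
    moreover have "N / 2 + T * (N / 2) + N * T\<^sup>2 / 2 + 6 * N + (3 * N + 2 * N) * T
        = 13 / 2 * N + 11 / 2 * (N * T) + 1 / 2 * (N * T\<^sup>2)"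
      "4 * N * (2 + 2 * T + T\<^sup>2) = 8 * N + 8 * (N * T) + 4 * (N * T\<^sup>2)"
      by (simp_all add: algebra_simps)
    ultimately show ?thesis using N by linarith
  qed
  finally show ?thesis using N by simp
qed

text \<open>The stability lemma with \<open>a = n/32\<close>, that is, Gaussian variance
  \<open>n/16\<close>. Every \<open>x\<close> between 0 and \<open>\<theta>\<close> inherits the
  bound \<open>T\<close>.\<close>

lemma mean_iexp_dev_gaussian:
  assumes n: "n \<ge> 2" and T: "\<bar>\<theta>\<bar> * sqrt (real n) \<le> T"
  shows "norm (mean n (\<lambda>t. iexp (\<theta> * dev n t)) - of_real (exp (- (real n / 32) * \<theta>\<^sup>2)))
    \<le> (2 + 2 * T + T\<^sup>2) * \<bar>\<theta>\<bar>"
proof (rule gaussian_ode_stability)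
  fix x :: real
  have "((\<lambda>x. iexp (x * c)) has_vector_derivative (\<i> * of_real c * iexp (x * c))) (at x)" for c
    by (rule has_vector_derivative_eq_rhs[OF vector_diff_chain_at[of "\<lambda>x. x * c" c x iexp, unfolded o_def]])
       (auto intro!: derivative_eq_intros has_vector_derivative_iexp simp: scaleR_conv_of_real)
  then show "((\<lambda>x. mean n (\<lambda>t. iexp (x * dev n t))) has_vector_derivative
      mean n (\<lambda>t. \<i> * of_real (dev n t) * iexp (x * dev n t))) (at x)"
    unfolding mean_def by (intro has_vector_derivative_divide has_vector_derivative_sum)
next
  fix x :: real assume "\<bar>x\<bar> \<le> \<bar>\<theta>\<bar>"
  then have "\<bar>x\<bar> * sqrt (real n) \<le> \<bar>\<theta>\<bar> * sqrt (real n)" by (intro mult_right_mono) auto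
  then show "norm (mean n (\<lambda>t. \<i> * of_real (dev n t) * iexp (x * dev n t))
            + of_real (2 * (real n / 32) * x) * mean n (\<lambda>t. iexp (x * dev n t))) \<le> 2 + 2 * T + T\<^sup>2"
    using T by (intro mean_iexp_dev_ode n) (rule order_trans)
qed (use n in \<open>simp_all add: mean_const\<close>)

section \<open>Propagating the Gaussian estimate to higher orders\<close>

lemma abs_exp_minus_diff_le:
  fixes x y :: real
  assumes "x \<ge> 0" "y \<ge> 0"
  shows "\<bar>exp (- x) - exp (- y)\<bar> \<le> \<bar>x - y\<bar>"
proof -
  have *: "exp (- u) - exp (- v) \<le> v - u" if "0 \<le> u" "u \<le> v" for u v :: real
  proof -
    have "exp (- u) - exp (- v) = exp (- u) * (1 - exp (u - v))"
      by (simp add: algebra_simps flip: exp_add)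
    also have "\<dots> \<le> 1 - exp (u - v)"
      using that by (intro mult_left_le_one_le) auto
    also have "\<dots> \<le> v - u" using exp_ge_add_one_self[of "u - v"] by linarith
    finally show ?thesis .
  qed
  show ?thesis
    using *[of x y] *[of y x] assms by (cases "x \<le> y") (auto simp: abs_if)
qed

text \<open>The limit variance; \<open>r\<close> counts prunings, so it belongs to branches of order \<open>r + 1\<close>.\<close>
definition branch_var :: "nat \<Rightarrow> real" where
  "branch_var r = 1 / 3 * ((4 ^ r - 1) / 16 ^ r)"

lemma branch_var_nonneg: "branch_var r \<ge> 0"
  by (simp add: branch_var_def)

text \<open>The law of total variance: about \<open>n/4\<close> leaves remain, each contributing
  \<open>branch_var r\<close>, and the variance \<open>n/16\<close> of their number enters scaled by
  \<open>1 / 16^r\<close>.\<close>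

lemma branch_var_Suc: "branch_var (Suc r) = branch_var r / 4 + 1 / 16 ^ Suc r"
  by (simp add: branch_var_def field_simps)

text \<open>The error is linear in \<open>\<theta>\<close> and uniform over all sizes with \<open>|\<theta>| sqrt n \<le> T\<close>; this region is
  stable under passing to smaller trees, which is what lets the induction condition on the pruned tree.\<close>
lemma mean_iexp_S_gaussian:
  "\<exists>C. \<forall>n>0. \<forall>\<theta>. \<bar>\<theta>\<bar> * sqrt (real n) \<le> T \<longrightarrow>
     norm (mean n (\<lambda>t. iexp (\<theta> * (real (S (Suc r) t) - real n / 4 ^ r)))
       - of_real (exp (- (branch_var r * real n * \<theta>\<^sup>2 / 2)))) \<le> C * \<bar>\<theta>\<bar>"
proof (induction r)
  case 0
  have "mean n (\<lambda>t. iexp (\<theta> * (real (S (Suc 0) t) - real n / 4 ^ 0))) = mean n (\<lambda>t. 1)" for n \<theta>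
    by (intro mean_cong) (simp add: S_1_eq_leaves[unfolded One_nat_def] mem_Omega)
  then show ?case
    by (intro exI[of _ 0]) (simp add: mean_const branch_var_def)
next
  case (Suc r)
  then obtain C where C: "norm (mean n (\<lambda>t. iexp (\<theta> * (real (S (Suc r) t) - real n / 4 ^ r)))
       - of_real (exp (- (branch_var r * real n * \<theta>\<^sup>2 / 2)))) \<le> C * \<bar>\<theta>\<bar>"
    if "n > 0" "\<bar>\<theta>\<bar> * sqrt (real n) \<le> T" for n \<theta>
    by blast
  define v where "v = branch_var r"
  define K where "K = 2 + 2 * T + T\<^sup>2"
  have v: "v \<ge> 0" by (simp add: v_def branch_var_nonneg)
  \<comment> \<open>For \<open>n = 1\<close> pruning is junk, but the branch count is 0, and both
    the characteristic function and the Gaussian differ from 1 by a multiple of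
    \<open>|\<theta>|\<close>.\<close>
  have small: "norm (mean n (\<lambda>t. iexp (\<theta> * (real (S (Suc (Suc r)) t) - real n / 4 ^ Suc r)))
       - of_real (exp (- (branch_var (Suc r) * real n * \<theta>\<^sup>2 / 2))))
     \<le> (1 + branch_var (Suc r) * T / 2) * \<bar>\<theta>\<bar>"
    if n: "n = 1" and T: "\<bar>\<theta>\<bar> * sqrt (real n) \<le> T" for n \<theta>
  proof -
    define w where "w = branch_var (Suc r)"
    have w: "w \<ge> 0" by (simp add: w_def branch_var_nonneg)
    have "mean n (\<lambda>t. iexp (\<theta> * (real (S (Suc (Suc r)) t) - real n / 4 ^ Suc r)))
        = iexp (- (\<theta> / 4 ^ Suc r))"
      using n by (simp add: S_def)
    moreover have "norm (iexp (- (\<theta> / 4 ^ Suc r)) - 1) \<le> \<bar>\<theta>\<bar>"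
    proof -
      have "norm (iexp (- (\<theta> / 4 ^ Suc r)) - 1) \<le> \<bar>- (\<theta> / 4 ^ Suc r)\<bar>"
        by (rule norm_iexp_minus_one_le)
      also have "\<dots> = \<bar>\<theta>\<bar> / 4 ^ Suc r" by simp
      also have "\<dots> \<le> \<bar>\<theta>\<bar> / 1" by (intro divide_left_mono one_le_power) auto
      finally show ?thesis by simp
    qed
    moreover have "norm (of_real (exp (- (w * real n * \<theta>\<^sup>2 / 2))) - 1 :: complex) \<le> w * T / 2 * \<bar>\<theta>\<bar>"
    proof -
      have "of_real (exp (- (w * real n * \<theta>\<^sup>2 / 2))) - 1
          = complex_of_real (exp (- (w * \<theta>\<^sup>2 / 2)) - exp (- 0))"
        using n by simp
      then have "norm (of_real (exp (- (w * real n * \<theta>\<^sup>2 / 2))) - 1 :: complex)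
          = \<bar>exp (- (w * \<theta>\<^sup>2 / 2)) - exp (- 0)\<bar>"
        by (simp only: norm_of_real)
      also have "\<dots> \<le> \<bar>w * \<theta>\<^sup>2 / 2 - 0\<bar>"
        using w by (intro abs_exp_minus_diff_le) auto
      also have "\<dots> = w / 2 * \<bar>\<theta>\<bar> * \<bar>\<theta>\<bar>" using w by (simp add: power2_eq_square abs_mult)
      also have "\<dots> \<le> w / 2 * T * \<bar>\<theta>\<bar>"
        using w n T by (intro mult_right_mono mult_left_mono) auto
      finally show ?thesis by simp
    qed
    ultimately show ?thesis
      unfolding w_def[symmetric]
      using norm_triangle_ineq4[of "iexp (- (\<theta> / 4 ^ Suc r)) - 1" "of_real (exp (- (w * real n * \<theta>\<^sup>2 / 2))) - 1"]
      by (simp add: algebra_simps)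
  qed
  have large: "norm (mean n (\<lambda>t. iexp (\<theta> * (real (S (Suc (Suc r)) t) - real n / 4 ^ Suc r)))
       - of_real (exp (- (branch_var (Suc r) * real n * \<theta>\<^sup>2 / 2))))
     \<le> (\<bar>C\<bar> + v * T / 2 + K) * \<bar>\<theta>\<bar>"
    if n: "n \<ge> 2" and T: "\<bar>\<theta>\<bar> * sqrt (real n) \<le> T" for n \<theta>
  proof -
    \<comment> \<open>A deviation \<open>y\<close> of the pruned size moves the conditional centre
      \<open>M / 4^r\<close> by \<open>y / 4^r\<close>, hence the frequency
      \<open>\<theta> / 4^r\<close> for \<open>dev\<close>.\<close>
    define \<phi> where "\<phi> = \<theta> / 4 ^ r"
    have \<phi>: "\<bar>\<phi>\<bar> \<le> \<bar>\<theta>\<bar>"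
    proof -
      have "\<bar>\<phi>\<bar> = \<bar>\<theta>\<bar> / 4 ^ r" by (simp add: \<phi>_def)
      also have "\<dots> \<le> \<bar>\<theta>\<bar> / 1" by (intro divide_left_mono one_le_power) auto
      finally show ?thesis by simp
    qed
    have T0: "T \<ge> 0"
      using T by (rule order_trans[rotated]) simp
    define M where "M t = leaves (prune t)" for t
    define \<Psi> where "\<Psi> m = mean m (\<lambda>s. iexp (\<theta> * (real (S (Suc r) s) - real m / 4 ^ r)))" for m
    define E where "E x = complex_of_real (exp (- (v * x * \<theta>\<^sup>2 / 2)))" for x
    have S_prune: "S (Suc (Suc r)) t = S (Suc r) (prune t)" if "t \<in> Omega n" for t
      using that n by (intro S_Suc_prune) (auto simp: mem_Omega)
    have "mean n (\<lambda>t. iexp (\<theta> * (real (S (Suc (Suc r)) t) - real n / 4 ^ Suc r)))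
        = mean n (\<lambda>t. iexp (\<theta> * (real (S (Suc r) (prune t)) - real n / 4 ^ Suc r)))"
      by (intro mean_cong) (simp add: S_prune)
    also have "\<dots> = mean n (\<lambda>t. mean (M t) (\<lambda>s. iexp (\<theta> * (real (S (Suc r) s) - real n / 4 ^ Suc r))))"
      unfolding M_def by (rule mean_prune[OF n])
    also have "\<dots> = mean n (\<lambda>t. iexp (\<phi> * dev n t) * \<Psi> (M t))"
    proof (intro mean_cong)
      fix t
      have "\<theta> * (a - real n / 4 ^ Suc r) = \<phi> * dev n t + \<theta> * (a - real (M t) / 4 ^ r)" for a
        by (simp add: \<phi>_def dev_def M_def field_simps)
      then show "mean (M t) (\<lambda>s. iexp (\<theta> * (real (S (Suc r) s) - real n / 4 ^ Suc r)))
          = iexp (\<phi> * dev n t) * \<Psi> (M t)"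
        unfolding \<Psi>_def mean_mult_left[symmetric]
        by (intro mean_cong) (simp only: of_real_add distrib_left exp_add)
    qed
    \<comment> \<open>Telescoping: replace \<open>\<Psi>\<close> by its Gaussian \<open>E\<close> at
      the random size, then that size by \<open>n / 4\<close>. The first two summands are errors;
      the third contains the characteristic function of \<open>dev\<close>.\<close>
    finally have "mean n (\<lambda>t. iexp (\<theta> * (real (S (Suc (Suc r)) t) - real n / 4 ^ Suc r)))
        = mean n (\<lambda>t. iexp (\<phi> * dev n t) * (\<Psi> (M t) - E (real (M t))))
          + mean n (\<lambda>t. iexp (\<phi> * dev n t) * (E (real (M t)) - E (real n / 4)))
          + E (real n / 4) * mean n (\<lambda>t. iexp (\<phi> * dev n t))"
      unfolding mean_add[symmetric] mean_mult_left[symmetric] by (simp add: algebra_simps)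
    \<comment> \<open>The variance recursion in exponential form.\<close>
    moreover have "complex_of_real (exp (- (branch_var (Suc r) * real n * \<theta>\<^sup>2 / 2)))
        = E (real n / 4) * of_real (exp (- (real n / 32) * \<phi>\<^sup>2))"
    proof -
      have "(16::real) ^ r = (4 ^ r)\<^sup>2" by (simp add: power2_eq_square flip: power_mult_distrib)
      then have eq: "branch_var (Suc r) * real n * \<theta>\<^sup>2 / 2 = v * (real n / 4) * \<theta>\<^sup>2 / 2 + (real n / 32) * \<phi>\<^sup>2"
        unfolding branch_var_Suc v_def[symmetric] by (simp add: \<phi>_def field_simps power_divide)
      show ?thesis
        unfolding E_def of_real_mult[symmetric] exp_add[symmetric] eq by (simp add: algebra_simps)
    qed
    ultimately have "mean n (\<lambda>t. iexp (\<theta> * (real (S (Suc (Suc r)) t) - real n / 4 ^ Suc r)))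
       - of_real (exp (- (branch_var (Suc r) * real n * \<theta>\<^sup>2 / 2)))
        = mean n (\<lambda>t. iexp (\<phi> * dev n t) * (\<Psi> (M t) - E (real (M t))))
          + mean n (\<lambda>t. iexp (\<phi> * dev n t) * (E (real (M t)) - E (real n / 4)))
          + E (real n / 4) * (mean n (\<lambda>t. iexp (\<phi> * dev n t)) - of_real (exp (- (real n / 32) * \<phi>\<^sup>2)))"
      by (simp add: right_diff_distrib)
    moreover have "norm (mean n (\<lambda>t. iexp (\<phi> * dev n t) * (\<Psi> (M t) - E (real (M t))))) \<le> \<bar>C\<bar> * \<bar>\<theta>\<bar>"
    proof (rule norm_mean_le_bound)
      fix t assume t: "t \<in> Omega n"
      have "M t \<le> n" using leaves_prune_le[OF n t] by (simp add: M_def)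
      then have "\<bar>\<theta>\<bar> * sqrt (real (M t)) \<le> \<bar>\<theta>\<bar> * sqrt (real n)" by (intro mult_left_mono) auto
      with T have "norm (\<Psi> (M t) - E (real (M t))) \<le> C * \<bar>\<theta>\<bar>"
        unfolding \<Psi>_def E_def v_def by (intro C) (auto simp: M_def)
      also have "\<dots> \<le> \<bar>C\<bar> * \<bar>\<theta>\<bar>" by (intro mult_right_mono) auto
      finally show "norm (iexp (\<phi> * dev n t) * (\<Psi> (M t) - E (real (M t)))) \<le> \<bar>C\<bar> * \<bar>\<theta>\<bar>"
        by (simp only: norm_mult norm_iexp mult_1)
    qed (use n in simp)
    moreover have "norm (mean n (\<lambda>t. iexp (\<phi> * dev n t) * (E (real (M t)) - E (real n / 4)))) \<le> v * T / 2 * \<bar>\<theta>\<bar>"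
    proof -
      have "norm (mean n (\<lambda>t. iexp (\<phi> * dev n t) * (E (real (M t)) - E (real n / 4))))
          \<le> mean n (\<lambda>t. norm (iexp (\<phi> * dev n t) * (E (real (M t)) - E (real n / 4))))"
        by (rule norm_mean_le)
      also have "\<dots> \<le> mean n (\<lambda>t. v * \<theta>\<^sup>2 / 2 * \<bar>dev n t\<bar>)"
      proof (intro mean_mono)
        fix t
        have "norm (E (real (M t)) - E (real n / 4))
            = \<bar>exp (- (v * real (M t) * \<theta>\<^sup>2 / 2)) - exp (- (v * (real n / 4) * \<theta>\<^sup>2 / 2))\<bar>"
          unfolding E_def of_real_diff[symmetric] norm_of_real ..
        also have "\<dots> \<le> \<bar>v * real (M t) * \<theta>\<^sup>2 / 2 - v * (real n / 4) * \<theta>\<^sup>2 / 2\<bar>"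
          using v by (intro abs_exp_minus_diff_le) auto
        also have "v * real (M t) * \<theta>\<^sup>2 / 2 - v * (real n / 4) * \<theta>\<^sup>2 / 2 = v * \<theta>\<^sup>2 / 2 * dev n t"
          by (simp add: dev_def M_def field_simps)
        also have "\<bar>v * \<theta>\<^sup>2 / 2 * dev n t\<bar> = v * \<theta>\<^sup>2 / 2 * \<bar>dev n t\<bar>"
          using v by (simp add: abs_mult)
        finally show "norm (iexp (\<phi> * dev n t) * (E (real (M t)) - E (real n / 4))) \<le> v * \<theta>\<^sup>2 / 2 * \<bar>dev n t\<bar>"
          by (simp only: norm_mult norm_iexp mult_1)
      qed
      also have "\<dots> = v * \<theta>\<^sup>2 / 2 * mean n (\<lambda>t. \<bar>dev n t\<bar>)" by (rule mean_mult_left)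
      also have "\<dots> \<le> v * \<theta>\<^sup>2 / 2 * sqrt (real n)"
        using v by (intro mult_left_mono mean_abs_dev_le n) auto
      \<comment> \<open>One factor \<open>|\<theta>|\<close> absorbs \<open>sqrt n\<close> into
        \<open>T\<close>; the other remains for the linear bound.\<close>
      also have "\<dots> = v / 2 * \<bar>\<theta>\<bar> * (\<bar>\<theta>\<bar> * sqrt (real n))" by (simp add: power2_eq_square)
      also have "\<dots> \<le> v / 2 * \<bar>\<theta>\<bar> * T" using v T by (intro mult_left_mono) auto
      finally show ?thesis by (simp add: mult_ac)
    qed
    moreover have "norm (E (real n / 4) * (mean n (\<lambda>t. iexp (\<phi> * dev n t)) - of_real (exp (- (real n / 32) * \<phi>\<^sup>2))))
        \<le> K * \<bar>\<theta>\<bar>"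
    proof -
      have "\<bar>\<phi>\<bar> * sqrt (real n) \<le> \<bar>\<theta>\<bar> * sqrt (real n)" using \<phi> by (intro mult_right_mono) auto
      with T have "norm (mean n (\<lambda>t. iexp (\<phi> * dev n t)) - of_real (exp (- (real n / 32) * \<phi>\<^sup>2))) \<le> K * \<bar>\<phi>\<bar>"
        unfolding K_def by (intro mean_iexp_dev_gaussian n) linarith
      also have "\<dots> \<le> K * \<bar>\<theta>\<bar>" using \<phi> T0 by (intro mult_left_mono) (auto simp: K_def)
      finally have "norm (mean n (\<lambda>t. iexp (\<phi> * dev n t)) - of_real (exp (- (real n / 32) * \<phi>\<^sup>2))) \<le> K * \<bar>\<theta>\<bar>" .
      moreover have "norm (E (real n / 4)) \<le> 1" using v by (simp add: E_def)
      ultimately have "norm (E (real n / 4)) * norm (mean n (\<lambda>t. iexp (\<phi> * dev n t)) - of_real (exp (- (real n / 32) * \<phi>\<^sup>2)))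
          \<le> 1 * (K * \<bar>\<theta>\<bar>)"
        by (intro mult_mono) auto
      then show ?thesis by (simp only: norm_mult mult_1)
    qed
    ultimately show ?thesis
      by (simp only: distrib_right) (intro norm_triangle_mono)
  qed
  define D where "D = max (1 + branch_var (Suc r) * T / 2) (\<bar>C\<bar> + v * T / 2 + K)"
  have "norm (mean n (\<lambda>t. iexp (\<theta> * (real (S (Suc (Suc r)) t) - real n / 4 ^ Suc r)))
       - of_real (exp (- (branch_var (Suc r) * real n * \<theta>\<^sup>2 / 2)))) \<le> D * \<bar>\<theta>\<bar>"
    if "n > 0" "\<bar>\<theta>\<bar> * sqrt (real n) \<le> T" for n \<theta>
  proof (cases "n = 1")
    case True
    have "(1 + branch_var (Suc r) * T / 2) * \<bar>\<theta>\<bar> \<le> D * \<bar>\<theta>\<bar>"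
      unfolding D_def by (intro mult_right_mono) auto
    with small[OF True that(2)] show ?thesis by linarith
  next
    case False
    then have "n \<ge> 2" using that by simp
    have "(\<bar>C\<bar> + v * T / 2 + K) * \<bar>\<theta>\<bar> \<le> D * \<bar>\<theta>\<bar>"
      unfolding D_def by (intro mult_right_mono) auto
    with large[OF \<open>n \<ge> 2\<close> that(2)] show ?thesis by linarith
  qed
  then show ?case by blast
qed

subsection \<open>Convergence in distribution\<close>

lemma char_centered_normal:
  assumes "\<sigma> > 0"
  shows "char (density lborel (normal_density 0 \<sigma>)) t = of_real (exp (- (\<sigma>\<^sup>2 * t\<^sup>2 / 2)))"
proof -
  let ?N = "std_normal_distribution"
  interpret real_distribution ?N by (rule real_dist_normal_dist)
  have "distributed ?N lborel (\<lambda>x. x) std_normal_density"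
    unfolding distributed_def by (simp add: distr_id2)
  from normal_density_affine[OF this, of \<sigma> 0]
  have "distributed ?N lborel (\<lambda>x. \<sigma> * x) (normal_density 0 \<sigma>)"
    using assms by simp
  then have "density lborel (normal_density 0 \<sigma>) = distr ?N lborel (\<lambda>x. \<sigma> * x)"
    by (simp add: distributed_def)
  then have "char (density lborel (normal_density 0 \<sigma>)) t = char ?N (t * \<sigma>)"
    unfolding char_def by (simp add: integral_distr mult.assoc)
  then show ?thesis
    by (simp add: char_std_normal_distribution power_mult_distrib mult.commute)
qed

text \<open>For \<open>n > 0\<close> the set \<open>Omega n\<close> is nonempty, so
  \<open>P n\<close> is indeed the uniform law.\<close>

lemma char_distr_P:
  assumes "n > 0"
  shows "char (distr (measure_pmf (P n)) borel X) t = mean n (\<lambda>\<tau>. iexp (t * X \<tau>))"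
proof -
  have ne: "Omega n \<noteq> {}" using card_Omega_pos[OF assms] by auto
  have "char (distr (measure_pmf (P n)) borel X) t = (CLINT \<tau>|measure_pmf (P n). iexp (t * X \<tau>))"
    unfolding char_def by (subst integral_distr) auto
  also have "\<dots> = (\<Sum>\<tau>\<in>Omega n. pmf (P n) \<tau> *\<^sub>R iexp (t * X \<tau>))"
    unfolding P_def using ne by (intro integral_measure_pmf) auto
  also have "\<dots> = mean n (\<lambda>\<tau>. iexp (t * X \<tau>))"
    unfolding P_def mean_def sum_divide_distrib using ne
    by (intro sum.cong refl) (simp add: scaleR_conv_of_real)
  finally show ?thesis .
qed

theorem theorem3:
  fixes r :: nat
  assumes "r \<ge> 1"
  shows "weak_conv_m
           (\<lambda>n. distr (measure_pmf (P n)) borel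
                  (\<lambda>t. sqrt (real n) * (real (S (r + 1) t) / real n - 1 / 4 ^ r)))
           (density lborel (normal_density 0 (sqrt ((1 / 3) * ((4 ^ r - 1) / 16 ^ r)))))"
proof (rule levy_continuity)
  define v where "v = branch_var r"
  \<comment> \<open>From \<open>r \<ge> 1\<close> the variance is positive, so the normal density is
    a genuine probability density.\<close>
  have "(1::real) < 4 ^ r" using assms by simp
  then have v: "v > 0" by (simp add: v_def branch_var_def)
  have sigma: "sqrt ((1 / 3) * ((4 ^ r - 1) / 16 ^ r)) = sqrt v"
    by (simp add: v_def branch_var_def)
  show "real_distribution (density lborel (normal_density 0 (sqrt ((1 / 3) * ((4 ^ r - 1) / 16 ^ r)))))"
    unfolding sigma using v
    by (auto simp: real_distribution_def real_distribution_axioms_def intro!: prob_space_normal_density)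
  show "real_distribution (distr (measure_pmf (P n)) borel
          (\<lambda>t. sqrt (real n) * (real (S (r + 1) t) / real n - 1 / 4 ^ r)))" for n
    by (intro prob_space.real_distribution_distr measure_pmf.prob_space_axioms) simp
  fix x :: real
  let ?c = "\<lambda>n. char (distr (measure_pmf (P n)) borel
          (\<lambda>t. sqrt (real n) * (real (S (r + 1) t) / real n - 1 / 4 ^ r))) x"
  obtain C where C: "norm (mean n (\<lambda>t. iexp (\<theta> * (real (S (Suc r) t) - real n / 4 ^ r)))
       - of_real (exp (- (branch_var r * real n * \<theta>\<^sup>2 / 2)))) \<le> C * \<bar>\<theta>\<bar>"
    if "n > 0" "\<bar>\<theta>\<bar> * sqrt (real n) \<le> \<bar>x\<bar>" for n \<theta>
    using mean_iexp_S_gaussian[of "\<bar>x\<bar>" r] by blast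
  have bound: "norm (?c n - of_real (exp (- (v * x\<^sup>2 / 2)))) \<le> C * \<bar>x\<bar> / sqrt (real n)" if n: "n > 0" for n
  proof -
    \<comment> \<open>With this scaling \<open>|\<theta>| * sqrt n = |x|\<close>, so one constant
      \<open>C\<close>, taken at \<open>T = |x|\<close>, serves all \<open>n > 0\<close>, and the
      error is of order \<open>1 / sqrt n\<close>.\<close>
    define \<theta> where "\<theta> = x / sqrt (real n)"
    have q: "sqrt (real n) > 0" "sqrt (real n) * sqrt (real n) = real n" using n by auto
    have "x * (sqrt (real n) * (a / real n - 1 / 4 ^ r)) = \<theta> * (a - real n / 4 ^ r)" for a
    proof -
      have "sqrt (real n) * (a / real n - 1 / 4 ^ r) = (a - real n / 4 ^ r) / sqrt (real n)"
      proof -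
        have "s * (a / (s * s) - c) = (a - (s * s) * c) / s" if "s > 0" for s c :: real
          using that by (simp add: field_simps)
        from this[OF q(1), of "1 / 4 ^ r"] show ?thesis by (simp only: q(2)) simp
      qed
      then show ?thesis by (simp add: \<theta>_def)
    qed
    then have "?c n = mean n (\<lambda>t. iexp (\<theta> * (real (S (Suc r) t) - real n / 4 ^ r)))"
      using n by (simp add: char_distr_P)
    moreover have "v * x\<^sup>2 / 2 = branch_var r * real n * \<theta>\<^sup>2 / 2"
      using n by (simp add: \<theta>_def power_divide v_def)
    moreover have "\<bar>\<theta>\<bar> * sqrt (real n) \<le> \<bar>x\<bar>" using q by (simp add: \<theta>_def)
    ultimately have "norm (?c n - of_real (exp (- (v * x\<^sup>2 / 2)))) \<le> C * \<bar>\<theta>\<bar>"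
      using C[OF n] by simp
    then show ?thesis by (simp add: \<theta>_def)
  qed
  have "(\<lambda>n. ?c n - of_real (exp (- (v * x\<^sup>2 / 2)))) \<longlonglongrightarrow> 0"
  proof (rule Lim_null_comparison)
    show "\<forall>\<^sub>F n in sequentially. norm (?c n - of_real (exp (- (v * x\<^sup>2 / 2)))) \<le> C * \<bar>x\<bar> / sqrt (real n)"
      using eventually_gt_at_top[of 0] by (rule eventually_mono) (rule bound)
    show "(\<lambda>n. C * \<bar>x\<bar> / sqrt (real n)) \<longlonglongrightarrow> 0"
      by (intro tendsto_divide_0[OF tendsto_const] filterlim_at_top_imp_at_infinity
          filterlim_compose[OF sqrt_at_top filterlim_real_sequentially])
  qed
  then have "?c \<longlonglongrightarrow> of_real (exp (- (v * x\<^sup>2 / 2)))"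
    by (rule LIM_zero_cancel)
  then show "?c \<longlonglongrightarrow> char (density lborel (normal_density 0 (sqrt ((1 / 3) * ((4 ^ r - 1) / 16 ^ r))))) x"
    unfolding sigma using v by (simp add: char_centered_normal)
qed

end
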